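(* Let $(\Omega,\mu)$ be a measure space, $\mathcal{H}_1,\mathcal{H}_2$ right quaternionic Hilbert spaces, $K_1\in\mathbb{B}(\mathcal{H}_1)$ and $K_2\in\mathbb{B}(\mathcal{H}_2)$. Let $F_1:\Omega\to\mathcal{H}_1$ be a continuous $K_1$-frame for $\mathcal{H}_1$ and $F_2:\Omega\to\mathcal{H}_2$ a continuous $K_2$-frame for $\mathcal{H}_2$, with transform operators $\theta_1$ and $\theta_2$, respectively. If $R(\theta_1)\perp R(\theta_2)$ in $L^2(\Omega,\mathbb{H})$, then $F_1\oplus F_2$ is a continuous $K_1\oplus K_2$-frame for $\mathcal{H}_1\oplus\mathcal{H}_2$.
   Context: $\mathbb{H}$ denotes the quaternions. A right quaternionic Hilbert space is a right $\mathbb{H}$-vector space $\mathcal{H}$ with an inner product $\langle\cdot,\cdot\rangle:\mathcal{H}\times\mathcal{H}\to\mathbb{H}$ such that $\langle u,v\rangle=\overline{\langle v,u\rangle}$, $\langle v,v\rangle>0$ for $v\neq0$, additive in the second variable with $\langle v,uq\rangle=\langle v,u\rangle q$ for $q\in\mathbb{H}$, and complete for $\|u\|=\sqrt{\langle u,u\rangle}$. $\mathbb{B}(\mathcal{H})$ is the set of bounded right $\mathbb{H}$-linear operators on $\mathcal{H}$, $L^*$ is the adjoint of $L$ and $R(L)$ its range. $L^2(\Omega,\mathbb{H})$ is the right quaternionic Hilbert space of measurable $g:\Omega\to\mathbb{H}$ with $\int_\Omega|g|^2d\mu<\infty$ (modulo a.e. equality), with $\langle g,h\rangle=\int_\Omega\overline{g(\omega)}h(\omega)\,d\mu(\omega)$.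 For $K\in\mathbb{B}(\mathcal{H})$, a weakly measurable $F:\Omega\to\mathcal{H}$ (i.e. $\omega\mapsto\langle F(\omega),u\rangle$ is measurable for each $u$) is a continuous $K$-frame for $\mathcal{H}$ if there are $0<A\leq B<\infty$ with $A\|K^*u\|^2\leq\int_\Omega|\langle F(\omega),u\rangle|^2d\mu(\omega)\leq B\|u\|^2$ for all $u\in\mathcal{H}$. Its transform operator $\theta:\mathcal{H}\to L^2(\Omega,\mathbb{H})$ is $\theta(u)(\omega)=\langle F(\omega),u\rangle$. $\mathcal{H}_1\oplus\mathcal{H}_2$ is the direct sum with inner product $\langle u_1\oplus v_1,u_2\oplus v_2\rangle=\langle u_1,u_2\rangle+\langle v_1,v_2\rangle$; $(K_1\oplus K_2)(u\oplus v)=K_1u\oplus K_2v$; $(F_1\oplus F_2)(\omega)=F_1(\omega)\oplus F_2(\omega)$. *)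

theory Defs
  imports "HOL-Analysis.Analysis"
begin

datatype quat = Quat (qRe: real) (qIm1: real) (qIm2: real) (qIm3: real)

lemma quat_eq_iff:
  "x = y \<longleftrightarrow> qRe x = qRe y \<and> qIm1 x = qIm1 y \<and> qIm2 x = qIm2 y \<and> qIm3 x = qIm3 y"
  using quat.expand by blast

instantiation quat :: ring_1
begin

definition "0 = Quat 0 0 0 0"
definition "1 = Quat 1 0 0 0"
definition "x + y = Quat (qRe x + qRe y) (qIm1 x + qIm1 y) (qIm2 x + qIm2 y) (qIm3 x + qIm3 y)"
definition "- x = Quat (- qRe x) (- qIm1 x) (- qIm2 x) (- qIm3 x)"
definition "x - y = Quat (qRe x - qRe y) (qIm1 x - qIm1 y) (qIm2 x - qIm2 y) (qIm3 x - qIm3 y)"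
definition "x * y = Quat
  (qRe x * qRe y - qIm1 x * qIm1 y - qIm2 x * qIm2 y - qIm3 x * qIm3 y)
  (qRe x * qIm1 y + qIm1 x * qRe y + qIm2 x * qIm3 y - qIm3 x * qIm2 y)
  (qRe x * qIm2 y - qIm1 x * qIm3 y + qIm2 x * qRe y + qIm3 x * qIm1 y)
  (qRe x * qIm3 y + qIm1 x * qIm2 y - qIm2 x * qIm1 y + qIm3 x * qRe y)"

instance
  by standard
    (simp_all add: quat_eq_iff zero_quat_def one_quat_def plus_quat_def uminus_quat_def
      minus_quat_def times_quat_def algebra_simps)

end

lemma quat_sel [simp]:
  "qRe 0 = 0" "qIm1 0 = 0" "qIm2 0 = 0" "qIm3 0 = 0"
  "qRe 1 = 1" "qIm1 1 = 0" "qIm2 1 = 0" "qIm3 1 = 0"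
  "qRe (x + y) = qRe x + qRe y" "qIm1 (x + y) = qIm1 x + qIm1 y"
  "qIm2 (x + y) = qIm2 x + qIm2 y" "qIm3 (x + y) = qIm3 x + qIm3 y"
  "qRe (x - y) = qRe x - qRe y" "qIm1 (x - y) = qIm1 x - qIm1 y"
  "qIm2 (x - y) = qIm2 x - qIm2 y" "qIm3 (x - y) = qIm3 x - qIm3 y"
  "qRe (- x) = - qRe x" "qIm1 (- x) = - qIm1 x"
  "qIm2 (- x) = - qIm2 x" "qIm3 (- x) = - qIm3 x"
  by (simp_all add: zero_quat_def one_quat_def plus_quat_def uminus_quat_def minus_quat_def)

lemma quat_sel_times:
  "qRe (x * y) = qRe x * qRe y - qIm1 x * qIm1 y - qIm2 x * qIm2 y - qIm3 x * qIm3 y"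
  "qIm1 (x * y) = qRe x * qIm1 y + qIm1 x * qRe y + qIm2 x * qIm3 y - qIm3 x * qIm2 y"
  "qIm2 (x * y) = qRe x * qIm2 y - qIm1 x * qIm3 y + qIm2 x * qRe y + qIm3 x * qIm1 y"
  "qIm3 (x * y) = qRe x * qIm3 y + qIm1 x * qIm2 y - qIm2 x * qIm1 y + qIm3 x * qRe y"
  by (simp_all add: times_quat_def)

definition qcnj :: "quat \<Rightarrow> quat" where
  "qcnj x = Quat (qRe x) (- qIm1 x) (- qIm2 x) (- qIm3 x)"

lemma qcnj_sel [simp]:
  "qRe (qcnj x) = qRe x" "qIm1 (qcnj x) = - qIm1 x"
  "qIm2 (qcnj x) = - qIm2 x" "qIm3 (qcnj x) = - qIm3 x"
  by (simp_all add: qcnj_def)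

instantiation quat :: real_algebra_1
begin

definition "scaleR r x = Quat (r * qRe x) (r * qIm1 x) (r * qIm2 x) (r * qIm3 x)"

instance
  by standard (simp_all add: scaleR_quat_def quat_eq_iff quat_sel_times algebra_simps)

end

lemma quat_sel_scaleR [simp]:
  "qRe (r *\<^sub>R x) = r * qRe x" "qIm1 (r *\<^sub>R x) = r * qIm1 x"
  "qIm2 (r *\<^sub>R x) = r * qIm2 x" "qIm3 (r *\<^sub>R x) = r * qIm3 x"
  by (simp_all add: scaleR_quat_def)

instantiation quat :: real_inner
begin

definition "inner x y = qRe x * qRe y + qIm1 x * qIm1 y + qIm2 x * qIm2 y + qIm3 x * qIm3 y"
definition "norm (x :: quat) = sqrt (inner x x)"
definition "sgn (x :: quat) = x /\<^sub>R norm x"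
definition "dist (x :: quat) y = norm (x - y)"
definition "(uniformity :: (quat \<times> quat) filter) = (INF e\<in>{0<..}. principal {(x, y). dist x y < e})"
definition "open (U :: quat set) \<longleftrightarrow>
  (\<forall>x\<in>U. eventually (\<lambda>(x', y). x' = x \<longrightarrow> y \<in> U) uniformity)"

instance
proof
  fix x y z :: quat and r :: real
  show "inner x y = inner y x"
    by (simp add: inner_quat_def algebra_simps)
  show "inner (x + y) z = inner x z + inner y z" "inner (r *\<^sub>R x) y = r * inner x y"
    by (simp_all add: inner_quat_def algebra_simps)
  show "0 \<le> inner x x"
    by (simp add: inner_quat_def)
  show "inner x x = 0 \<longleftrightarrow> x = 0"
    by (auto simp: inner_quat_def quat_eq_iff add_nonneg_eq_0_iff)
qed (simp_all add: norm_quat_def sgn_quat_def dist_quat_def uniformity_quat_def open_quat_def)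

end

instance quat :: real_normed_algebra_1
proof
  fix x y :: quat
  have "inner (x * y) (x * y) = inner x x * inner y y"
    unfolding inner_quat_def quat_sel_times by algebra
  then show "norm (x * y) \<le> norm x * norm y"
    by (simp add: norm_quat_def real_sqrt_mult)
  show "norm (1 :: quat) = 1"
    by (simp add: norm_quat_def inner_quat_def)
qed

instantiation quat :: euclidean_space
begin

definition "Basis = {Quat 1 0 0 0, Quat 0 1 0 0, Quat 0 0 1 0, Quat 0 0 0 1}"

instance
proof
  show "(Basis :: quat set) \<noteq> {}" "finite (Basis :: quat set)"
    by (simp_all add: Basis_quat_def)
  show "inner u v = (if u = v then 1 else 0)" if "u \<in> Basis" "v \<in> Basis" for u v :: quat
    using that unfolding Basis_quat_def by (elim insertE emptyE) (simp_all add: inner_quat_def)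
  show "(\<forall>u\<in>Basis. inner x u = 0) \<longleftrightarrow> x = 0" for x :: quat
    by (simp add: Basis_quat_def inner_quat_def quat_eq_iff[of x 0])
qed

end

lemma bounded_linear_qcnj: "bounded_linear qcnj"
  by (rule bounded_linear_intro[where K = 1])
    (simp_all add: quat_eq_iff norm_quat_def inner_quat_def)

lemma qcnj_measurable [measurable]: "qcnj \<in> borel_measurable borel"
  by (intro borel_measurable_continuous_onI linear_continuous_on bounded_linear_qcnj)

text \<open>
  The real vector space structure and the norm inherited from the class \<open>banach\<close> are not
  additional data: they are determined by the right scalar multiplication and the inner product.
  Completeness with respect to this norm comes from \<open>banach\<close>. By conjugate symmetry
  \<open>qinner v v\<close> is always real, so that its positivity can be expressed by \<open>qRe\<close>.
\<close>

class right_quat_hilbert = banach +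
  fixes scaleQ :: "'a \<Rightarrow> quat \<Rightarrow> 'a"  (infixl \<open>\<cdot>\<^sub>Q\<close> 75)
    and qinner :: "'a \<Rightarrow> 'a \<Rightarrow> quat"
  assumes scaleQ_add_left: "(x + y) \<cdot>\<^sub>Q p = x \<cdot>\<^sub>Q p + y \<cdot>\<^sub>Q p"
    and scaleQ_add_right: "x \<cdot>\<^sub>Q (p + q) = x \<cdot>\<^sub>Q p + x \<cdot>\<^sub>Q q"
    and scaleQ_mult: "x \<cdot>\<^sub>Q (p * q) = (x \<cdot>\<^sub>Q p) \<cdot>\<^sub>Q q"
    and scaleQ_one: "x \<cdot>\<^sub>Q 1 = x"
    and scaleQ_of_real: "x \<cdot>\<^sub>Q of_real r = r *\<^sub>R x"
    and qinner_cnj: "qinner x y = qcnj (qinner y x)"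
    and qinner_pos: "x \<noteq> 0 \<Longrightarrow> qRe (qinner x x) > 0"
    and qinner_add_right: "qinner x (y + z) = qinner x y + qinner x z"
    and qinner_scaleQ_right: "qinner x (y \<cdot>\<^sub>Q q) = qinner x y * q"
    and norm_qinner: "norm x = sqrt (qRe (qinner x x))"

text \<open>Direct sum; the norm on products from the library is the one induced by this inner product.\<close>

instantiation prod :: (right_quat_hilbert, right_quat_hilbert) right_quat_hilbert
begin

definition "x \<cdot>\<^sub>Q q = (fst x \<cdot>\<^sub>Q q, snd x \<cdot>\<^sub>Q q)"
definition "qinner x y = qinner (fst x) (fst y) + qinner (snd x) (snd y)"

instance
proof
  have nonneg: "qRe (qinner a a) \<ge> 0" for a :: "'c :: right_quat_hilbert"
  proof (cases "a = 0")
    case True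
    have "qinner a (0 + 0) = qinner a 0 + qinner a 0" by (rule qinner_add_right)
    with True show ?thesis by simp
  next
    case False
    then show ?thesis using qinner_pos[of a] by simp
  qed
  fix x y z :: "'a \<times> 'b" and p q :: quat and r :: real
  show "(x + y) \<cdot>\<^sub>Q p = x \<cdot>\<^sub>Q p + y \<cdot>\<^sub>Q p" "x \<cdot>\<^sub>Q (p + q) = x \<cdot>\<^sub>Q p + x \<cdot>\<^sub>Q q"
    "x \<cdot>\<^sub>Q (p * q) = (x \<cdot>\<^sub>Q p) \<cdot>\<^sub>Q q" "x \<cdot>\<^sub>Q 1 = x" "x \<cdot>\<^sub>Q of_real r = r *\<^sub>R x"
    by (simp_all add: scaleQ_prod_def prod_eq_iff scaleQ_add_left scaleQ_add_right
        scaleQ_mult scaleQ_one scaleQ_of_real)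
  show "qinner x y = qcnj (qinner y x)"
    using qinner_cnj[of "fst x" "fst y"] qinner_cnj[of "snd x" "snd y"]
    by (simp add: qinner_prod_def quat_eq_iff)
  show "qRe (qinner x x) > 0" if "x \<noteq> 0"
  proof (cases "fst x = 0")
    case True
    with that have "snd x \<noteq> 0" by (simp add: prod_eq_iff)
    then show ?thesis
      using qinner_pos[of "snd x"] nonneg[of "fst x"] by (simp add: qinner_prod_def)
  next
    case False
    then show ?thesis
      using qinner_pos[of "fst x"] nonneg[of "snd x"] by (simp add: qinner_prod_def)
  qed
  show "qinner x (y + z) = qinner x y + qinner x z"
    by (simp add: qinner_prod_def qinner_add_right)
  show "qinner x (y \<cdot>\<^sub>Q q) = qinner x y * q"
    by (simp add: qinner_prod_def scaleQ_prod_def qinner_scaleQ_right distrib_right)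
  show "norm x = sqrt (qRe (qinner x x))"
    using nonneg[of "fst x"] nonneg[of "snd x"]
    by (simp add: norm_prod_def qinner_prod_def norm_qinner)
qed

end

definition bounded_qlinear :: "('a::right_quat_hilbert \<Rightarrow> 'b::right_quat_hilbert) \<Rightarrow> bool" where
  "bounded_qlinear L \<longleftrightarrow>
     (\<forall>x y. L (x + y) = L x + L y) \<and>
     (\<forall>x q. L (x \<cdot>\<^sub>Q q) = L x \<cdot>\<^sub>Q q) \<and>
     (\<exists>C. \<forall>x. norm (L x) \<le> C * norm x)"

text \<open>For bounded \<open>L\<close> the adjoint exists (Riesz) and is unique, so \<open>THE\<close> is well-defined.\<close>

definition qadjoint :: "('a::right_quat_hilbert \<Rightarrow> 'b::right_quat_hilbert) \<Rightarrow> 'b \<Rightarrow> 'a" where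
  "qadjoint L = (THE L'. \<forall>u v. qinner (L u) v = qinner u (L' v))"

definition sq_integrable :: "'o measure \<Rightarrow> ('o \<Rightarrow> quat) set" where
  "sq_integrable M =
     {g. g \<in> borel_measurable M \<and> (\<integral>\<^sup>+ \<omega>. ennreal ((norm (g \<omega>))\<^sup>2) \<partial>M) < \<infinity>}"

definition L2_rel :: "'o measure \<Rightarrow> (('o \<Rightarrow> quat) \<times> ('o \<Rightarrow> quat)) set" where
  "L2_rel M = {(g, h). g \<in> sq_integrable M \<and> h \<in> sq_integrable M \<and> (AE \<omega> in M. g \<omega> = h \<omega>)}"

definition L2 :: "'o measure \<Rightarrow> ('o \<Rightarrow> quat) set set" where
  "L2 M = sq_integrable M // L2_rel M"

text \<open>By \<open>L2_inner_class\<close> below, the choice of representatives is immaterial.\<close>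

definition L2_inner :: "'o measure \<Rightarrow> ('o \<Rightarrow> quat) set \<Rightarrow> ('o \<Rightarrow> quat) set \<Rightarrow> quat" where
  "L2_inner M X Y = (\<integral> \<omega>. qcnj ((SOME g. g \<in> X) \<omega>) * (SOME h. h \<in> Y) \<omega> \<partial>M)"

lemma equiv_L2_rel: "equiv (sq_integrable M) (L2_rel M)"
proof (rule equivI)
  show "L2_rel M \<subseteq> sq_integrable M \<times> sq_integrable M"
    by (auto simp: L2_rel_def)
  show "refl_on (sq_integrable M) (L2_rel M)"
    by (auto simp: refl_on_def L2_rel_def)
  show "sym (L2_rel M)"
    by (auto simp: sym_def L2_rel_def eq_commute)
  have "AE \<omega> in M. f \<omega> = h \<omega>"
    if "AE \<omega> in M. f \<omega> = g \<omega>" "AE \<omega> in M. g \<omega> = h \<omega>" for f g h :: "'a \<Rightarrow> quat"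
    using that by eventually_elim simp
  then show "trans (L2_rel M)"
    unfolding trans_def L2_rel_def by blast
qed

lemma L2_inner_class:
  assumes g: "g \<in> sq_integrable M" and h: "h \<in> sq_integrable M"
  shows "L2_inner M (L2_rel M `` {g}) (L2_rel M `` {h}) = (\<integral> \<omega>. qcnj (g \<omega>) * h \<omega> \<partial>M)"
proof -
  have *: "(f, SOME f'. f' \<in> L2_rel M `` {f}) \<in> L2_rel M" if "f \<in> sq_integrable M" for f
  proof -
    have "f \<in> L2_rel M `` {f}" using that by (simp add: L2_rel_def)
    then have "(SOME f'. f' \<in> L2_rel M `` {f}) \<in> L2_rel M `` {f}"
      by (rule someI[where P = "\<lambda>f'. f' \<in> L2_rel M `` {f}"])
    then show ?thesis by simp
  qed
  define g' where "g' = (SOME f'. f' \<in> L2_rel M `` {g})"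
  define h' where "h' = (SOME f'. f' \<in> L2_rel M `` {h})"
  have [measurable]: "g \<in> borel_measurable M" "h \<in> borel_measurable M"
      "g' \<in> borel_measurable M" "h' \<in> borel_measurable M"
    and "AE \<omega> in M. g \<omega> = g' \<omega>" "AE \<omega> in M. h \<omega> = h' \<omega>"
    using *[OF g] *[OF h] by (auto simp: g'_def h'_def L2_rel_def sq_integrable_def)
  from this(5,6) have "AE \<omega> in M. qcnj (g' \<omega>) * h' \<omega> = qcnj (g \<omega>) * h \<omega>"
    by eventually_elim simp
  then have "(\<integral> \<omega>. qcnj (g' \<omega>) * h' \<omega> \<partial>M) = (\<integral> \<omega>. qcnj (g \<omega>) * h \<omega> \<partial>M)"
    by (intro integral_cong_AE) measurable
  then show ?thesis
    by (simp add: L2_inner_def g'_def h'_def)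
qed

definition L2_orthogonal :: "'o measure \<Rightarrow> ('o \<Rightarrow> quat) set set \<Rightarrow> ('o \<Rightarrow> quat) set set \<Rightarrow> bool" where
  "L2_orthogonal M S T \<longleftrightarrow> (\<forall>X\<in>S. \<forall>Y\<in>T. L2_inner M X Y = 0)"

definition weakly_measurable :: "'o measure \<Rightarrow> ('o \<Rightarrow> 'a::right_quat_hilbert) \<Rightarrow> bool" where
  "weakly_measurable M F \<longleftrightarrow> (\<forall>u. (\<lambda>\<omega>. qinner (F \<omega>) u) \<in> borel_measurable M)"

definition continuous_K_frame ::
    "'o measure \<Rightarrow> ('a::right_quat_hilbert \<Rightarrow> 'a) \<Rightarrow> ('o \<Rightarrow> 'a) \<Rightarrow> bool" where
  "continuous_K_frame M K F \<longleftrightarrow>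
     bounded_qlinear K \<and> weakly_measurable M F \<and>
     (\<exists>A B :: real. 0 < A \<and> A \<le> B \<and>
       (\<forall>u. ennreal (A * (norm (qadjoint K u))\<^sup>2)
               \<le> (\<integral>\<^sup>+ \<omega>. ennreal ((norm (qinner (F \<omega>) u))\<^sup>2) \<partial>M) \<and>
            (\<integral>\<^sup>+ \<omega>. ennreal ((norm (qinner (F \<omega>) u))\<^sup>2) \<partial>M)
               \<le> ennreal (B * (norm u)\<^sup>2)))"

definition transform_op ::
    "'o measure \<Rightarrow> ('o \<Rightarrow> 'a::right_quat_hilbert) \<Rightarrow> 'a \<Rightarrow> ('o \<Rightarrow> quat) set" where
  "transform_op M F u = L2_rel M `` {\<lambda>\<omega>. qinner (F \<omega>) u}"

lemma transform_op_in_L2: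
  assumes "continuous_K_frame M K F"
  shows "transform_op M F u \<in> L2 M"
proof -
  have "(\<lambda>\<omega>. qinner (F \<omega>) u) \<in> sq_integrable M"
    using assms
    by (auto simp: continuous_K_frame_def weakly_measurable_def sq_integrable_def
        intro: le_less_trans)
  then show ?thesis
    unfolding transform_op_def L2_def by (rule quotientI)
qed

end

theory Submission
  imports Defs
begin

text \<open>
  The transform of \<open>F\<^sub>1 \<oplus> F\<^sub>2\<close> at \<open>(u, v)\<close> is the pointwise sum of the transforms \<open>g\<close> of \<open>F\<^sub>1\<close> at
  \<open>u\<close> and \<open>h\<close> of \<open>F\<^sub>2\<close> at \<open>v\<close>. Orthogonality of the two ranges kills the cross term of the squared
  norm, so that Pythagoras holds in \<open>L\<^sup>2\<close> (\<open>nn_integral_norm_add_orthogonal\<close>):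
  \<open>\<integral>\<bar>g + h\<bar>\<^sup>2 = \<integral>\<bar>g\<bar>\<^sup>2 + \<integral>\<bar>h\<bar>\<^sup>2\<close>. The norm of the direct sum satisfies
  \<open>\<parallel>(u, v)\<parallel>\<^sup>2 = \<parallel>u\<parallel>\<^sup>2 + \<parallel>v\<parallel>\<^sup>2\<close>, and the adjoint of \<open>K\<^sub>1 \<oplus> K\<^sub>2\<close> acts componentwise. Adding the two
  pairs of frame inequalities therefore gives those of the direct sum, with the smaller of the
  lower bounds and the larger of the upper bounds.

  The analytic content lies in the adjoint. Because \<open>qadjoint\<close> is a definite description, its value
  at \<open>K\<^sub>1 \<oplus> K\<^sub>2\<close> can only be computed once \<open>K\<^sub>1\<close> and \<open>K\<^sub>2\<close> are known to have adjoints, and this is the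
  Riesz representation theorem. The latter is proved for the real inner product
  \<open>qRe (qinner x y)\<close> and real functionals (\<open>real_riesz_representation\<close>); right linearity
  then upgrades an identity between real parts to one between quaternions
  (\<open>quat_eqI_qRe_times\<close>).
\<close>

section \<open>Quaternions\<close>

lemma qRe_qcnj_times: "qRe (qcnj p * q) = inner p q"
  by (simp add: quat_sel_times inner_quat_def)

lemma bounded_linear_qRe: "bounded_linear qRe"
proof (rule bounded_linear_intro[where K = 1])
  fix x :: quat
  have "(qRe x)\<^sup>2 \<le> inner x x"
    by (simp add: inner_quat_def power2_eq_square)
  then show "norm (qRe x) \<le> norm x * 1"
    by (simp add: norm_quat_def real_le_rsqrt)
qed simp_all

lemma norm_qcnj: "norm (qcnj x) = norm x"
  by (simp add: norm_quat_def inner_quat_def)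

text \<open>
  The real bilinear form \<open>(p, q) \<mapsto> qRe (p * q)\<close> is nondegenerate: pairing the difference of \<open>p\<close> and \<open>p'\<close> with
  its own conjugate gives its squared norm.
\<close>

lemma quat_eqI_qRe_times:
  assumes "\<And>q. qRe (p * q) = qRe (p' * q)"
  shows "p = p'"
proof -
  have "qRe ((p - p') * qcnj (p - p')) = 0"
    using assms[of "qcnj (p - p')"] by (simp add: left_diff_distrib)
  then have "inner (p - p') (p - p') = 0"
    by (simp add: quat_sel_times inner_quat_def algebra_simps)
  then show ?thesis
    by simp
qed

section \<open>The underlying real inner product\<close>

lemma qinner_zero_right [simp]: "qinner x 0 = 0"
  using qinner_add_right[of x 0 0] by simp

lemma qinner_scaleR_right: "qinner x (r *\<^sub>R y) = r *\<^sub>R qinner x y"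
  by (simp add: scaleQ_of_real[symmetric] qinner_scaleQ_right of_real_def)

lemma qinner_minus_right: "qinner x (- y) = - qinner x y"
  using qinner_scaleR_right[of x "- 1" y] by simp

lemma qinner_diff_right: "qinner x (y - z) = qinner x y - qinner x z"
  using qinner_add_right[of x y "- z"] by (simp add: qinner_minus_right)

lemma qRe_qinner_commute: "qRe (qinner x y) = qRe (qinner y x)"
  by (metis qinner_cnj qcnj_sel(1))

lemma qRe_qinner_self: "qRe (qinner x x) = (norm x)\<^sup>2"
proof (cases "x = 0")
  case False
  then have "qRe (qinner x x) > 0" by (rule qinner_pos)
  then show ?thesis by (simp add: norm_qinner)
qed simp

lemma norm_add_sq: "(norm (x + y))\<^sup>2 = (norm x)\<^sup>2 + (norm y)\<^sup>2 + 2 * qRe (qinner x y)"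
  for x y :: "'a::right_quat_hilbert"
  by (simp add: qRe_qinner_self[symmetric] qinner_add_right
      qRe_qinner_commute[of "x + y"])
    (simp add: qRe_qinner_commute[of x y])

lemma parallelogram_law:
  "(norm (x + y))\<^sup>2 + (norm (x - y))\<^sup>2 = 2 * (norm x)\<^sup>2 + 2 * (norm y)\<^sup>2"
  for x y :: "'a::right_quat_hilbert"
  using norm_add_sq[of x y] norm_add_sq[of x "- y"] by (simp add: qinner_minus_right)

text \<open>
  The norm already satisfies the triangle inequality, so Cauchy--Schwarz is read off from
  the expansion of \<open>\<parallel>x + y\<parallel>\<^sup>2 \<le> (\<parallel>x\<parallel> + \<parallel>y\<parallel>)\<^sup>2\<close>.
\<close>

lemma qRe_qinner_le: "qRe (qinner x y) \<le> norm x * norm y"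
proof -
  have "(norm (x + y))\<^sup>2 \<le> (norm x + norm y)\<^sup>2"
    by (intro power_mono norm_triangle_ineq) simp
  then show ?thesis
    by (simp add: norm_add_sq power2_sum)
qed

lemma abs_qRe_qinner_le: "\<bar>qRe (qinner x y)\<bar> \<le> norm x * norm y"
  using qRe_qinner_le[of x y] qRe_qinner_le[of x "- y"] by (simp add: qinner_minus_right)

lemma qinner_left_unique:
  assumes "\<And>x. qinner v x = qinner w x"
  shows "v = w"
proof -
  have "qRe (qinner (v - w) (v - w)) = 0"
    using assms[of "v - w"]
    by (simp add: qRe_qinner_commute[of "v - w"] qinner_diff_right)
  then show ?thesis
    using qinner_pos[of "v - w"] by force
qed

section \<open>Riesz representation and the adjoint\<close>

text \<open>
  A bounded real functional \<open>f\<close> is represented by the minimiser \<open>w\<close> of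
  \<open>J x = \<parallel>x\<parallel>\<^sup>2 - 2 * f x\<close>. Boundedness of \<open>f\<close> makes \<open>J\<close> bounded below, the parallelogram
  law makes every minimising sequence Cauchy, and vanishing of the first variation of \<open>J\<close> at \<open>w\<close> is the
  equation \<open>qRe (qinner w x) = f x\<close>.
\<close>

lemma real_riesz_representation:
  fixes f :: "'a::right_quat_hilbert \<Rightarrow> real"
  assumes f: "bounded_linear f"
  obtains w where "\<And>x. f x = qRe (qinner w x)"
proof -
  interpret f: bounded_linear f by (rule f)
  define J where "J x = (norm x)\<^sup>2 - 2 * f x" for x
  obtain C where C: "\<And>x. \<bar>f x\<bar> \<le> norm x * C"
    using f.bounded by auto
  have lower: "- C\<^sup>2 \<le> J x" for x
  proof -
    have "0 \<le> (norm x - C)\<^sup>2" by simp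
    then show ?thesis
      using C[of x] by (simp add: J_def power2_diff)
  qed
  define m where "m = (INF x. J x)"
  have bdd: "bdd_below (range J)"
    using lower by (intro bdd_belowI2)
  have m_le: "m \<le> J x" for x
    unfolding m_def by (rule cINF_lower[OF bdd]) simp
  have "\<exists>x. J x < m + 1 / real (Suc n)" for n
  proof (rule ccontr)
    assume "\<not> ?thesis"
    then have "m + 1 / real (Suc n) \<le> m"
      unfolding m_def[symmetric] by (subst (2) m_def) (auto intro!: cINF_greatest simp: not_less)
    then show False by simp
  qed
  then obtain X where X: "\<And>n. J (X n) < m + 1 / real (Suc n)"
    by metis
  \<comment> \<open>By the parallelogram law the left side is \<open>2 * J x + 2 * J y\<close> minus four times the value of
    \<open>J\<close> at the midpoint, which is at least \<open>m\<close>.\<close>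
  have gap: "(norm (x - y))\<^sup>2 \<le> 2 * (J x - m) + 2 * (J y - m)" for x y
  proof -
    have "J ((1/2) *\<^sub>R (x + y)) = (norm (x + y))\<^sup>2 / 4 - f x - f y"
      by (simp only: J_def f.scaleR f.add norm_scaleR) (simp add: power2_eq_square field_simps)
    then show ?thesis
      using m_le[of "(1/2) *\<^sub>R (x + y)"] parallelogram_law[of x y]
      by (simp add: J_def)
  qed
  have "Cauchy X"
  proof (rule metric_CauchyI)
    fix e :: real assume e: "0 < e"
    then obtain N where N: "1 / real (Suc N) < e\<^sup>2 / 4"
      using reals_Archimedean[of "e\<^sup>2 / 4"] by (auto simp: inverse_eq_divide)
    have small: "4 * (J (X n) - m) < e\<^sup>2" if "N \<le> n" for n
    proof -
      have "1 / real (Suc n) \<le> 1 / real (Suc N)"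
        using that by (simp add: frac_le)
      then have "J (X n) - m < e\<^sup>2 / 4" using X[of n] N by linarith
      then show ?thesis by simp
    qed
    have "dist (X i) (X j) < e" if "N \<le> i" "N \<le> j" for i j
    proof -
      have "(norm (X i - X j))\<^sup>2 < e\<^sup>2"
        using gap[of "X i" "X j"] small[OF that(1)] small[OF that(2)] by linarith
      then show ?thesis
        using e by (simp add: dist_norm power_less_imp_less_base)
    qed
    then show "\<exists>N. \<forall>i\<ge>N. \<forall>j\<ge>N. dist (X i) (X j) < e"
      by blast
  qed
  then obtain w where w: "X \<longlonglongrightarrow> w"
    by (auto simp: Cauchy_convergent_iff convergent_def)
  have "(\<lambda>n. J (X n)) \<longlonglongrightarrow> J w"
    unfolding J_def by (intro tendsto_intros f.tendsto w)
  moreover have "(\<lambda>n. m + 1 / real (Suc n)) \<longlonglongrightarrow> m + 0"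
    by (intro tendsto_add tendsto_const LIMSEQ_Suc[OF lim_1_over_n])
  ultimately have "J w \<le> m"
    using X by (intro LIMSEQ_le[of "\<lambda>n. J (X n)" _ _ m]) (auto intro: less_imp_le)
  then have min: "J w \<le> J x" for x
    using m_le[of x] by linarith
  have "f x = qRe (qinner w x)" for x
  proof (rule ccontr)
    assume neq: "f x \<noteq> qRe (qinner w x)"
    define d where "d = f x - qRe (qinner w x)"
    have quad: "2 * t * d \<le> t\<^sup>2 * (norm x)\<^sup>2" for t
      using min[of "w + t *\<^sub>R x"]
      by (simp add: J_def d_def norm_add_sq f.add f.scaleR qinner_scaleR_right
          power_mult_distrib algebra_simps)
    \<comment> \<open>The parabola \<open>t\<^sup>2 * (\<parallel>x\<parallel>\<^sup>2 + 1) - 2 * t * d\<close> has its vertex here, with value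
      \<open>- d\<^sup>2 / (\<parallel>x\<parallel>\<^sup>2 + 1)\<close>; the added \<open>1\<close> avoids a case distinction on \<open>x = 0\<close>.\<close>
    define t where "t = d / ((norm x)\<^sup>2 + 1)"
    have pos: "0 < (norm x)\<^sup>2 + 1" by (simp add: add_nonneg_pos)
    then have td: "t * ((norm x)\<^sup>2 + 1) = d" by (simp add: t_def)
    have "2 * t * (t * ((norm x)\<^sup>2 + 1)) \<le> t\<^sup>2 * (norm x)\<^sup>2"
      using quad[of t] td by simp
    then have "t\<^sup>2 * ((norm x)\<^sup>2 + 2) \<le> 0"
      by (simp add: algebra_simps power2_eq_square)
    moreover have "t \<noteq> 0" using td neq by (auto simp: d_def)
    then have "0 < t\<^sup>2 * ((norm x)\<^sup>2 + 2)"
      by (intro mult_pos_pos) (auto simp: add_nonneg_pos)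
    ultimately show False by simp
  qed
  then show ?thesis by (rule that)
qed

lemma bounded_qlinear_imp_bounded_linear:
  assumes "bounded_qlinear L"
  shows "bounded_linear L"
proof -
  obtain C where C: "\<And>x. norm (L x) \<le> C * norm x"
    using assms by (auto simp: bounded_qlinear_def)
  show ?thesis
  proof (rule bounded_linear_intro[where K = C])
    show "L (x + y) = L x + L y" for x y
      using assms by (simp add: bounded_qlinear_def)
    show "L (r *\<^sub>R x) = r *\<^sub>R L x" for r x
      using assms by (metis bounded_qlinear_def scaleQ_of_real)
    show "norm (L x) \<le> norm x * C" for x
      using C[of x] by (simp add: mult.commute)
  qed
qed

text \<open>
  Riesz applied to \<open>x \<mapsto> qRe (qinner v (L x))\<close> yields equality of real parts only; evaluating it at
  all multiples \<open>x \<cdot>\<^sub>Q q\<close> recovers the full quaternionic identity.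
\<close>

lemma adjoint_value_exists:
  assumes L: "bounded_qlinear L"
  shows "\<exists>w. \<forall>x. qinner v (L x) = qinner w x"
proof -
  have "bounded_linear (\<lambda>y. qRe (qinner v y))"
    by (rule bounded_linear_intro[where K = "norm v"])
      (use abs_qRe_qinner_le[of v] in
        \<open>simp_all add: qinner_add_right qinner_scaleR_right mult.commute\<close>)
  then have "bounded_linear (\<lambda>x. qRe (qinner v (L x)))"
    using bounded_qlinear_imp_bounded_linear[OF L] by (rule bounded_linear_compose)
  then obtain w where w: "\<And>x. qRe (qinner v (L x)) = qRe (qinner w x)"
    by (rule real_riesz_representation) blast
  have "qinner v (L x) = qinner w x" for x
  proof (rule quat_eqI_qRe_times)
    fix q
    show "qRe (qinner v (L x) * q) = qRe (qinner w x * q)"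
      using w[of "x \<cdot>\<^sub>Q q"] L by (simp add: bounded_qlinear_def qinner_scaleQ_right)
  qed
  then show ?thesis by blast
qed

lemma qadjoint_eqI:
  assumes "\<And>u v. qinner (L u) v = qinner u (L' v)"
  shows "qadjoint L = L'"
  unfolding qadjoint_def
proof (rule the_equality)
  show "\<forall>u v. qinner (L u) v = qinner u (L' v)"
    using assms by blast
next
  fix L'' assume L'': "\<forall>u v. qinner (L u) v = qinner u (L'' v)"
  show "L'' = L'"
  proof
    fix v
    have "qinner (L'' v) x = qinner (L' v) x" for x
      using L'' assms by (metis qinner_cnj)
    then show "L'' v = L' v" by (rule qinner_left_unique)
  qed
qed

lemma qinner_qadjoint:
  assumes "bounded_qlinear L"
  shows "qinner (L u) v = qinner u (qadjoint L v)"
proof -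
  obtain L' where L': "\<And>v x. qinner v (L x) = qinner (L' v) x"
    using adjoint_value_exists[OF assms] by metis
  have adj: "qinner (L u) v = qinner u (L' v)" for u v
    using L'[of v u] by (metis qinner_cnj)
  show ?thesis
    by (simp add: qadjoint_eqI[OF adj] adj)
qed

section \<open>Direct sums of operators\<close>

lemma bounded_qlinear_map_prod:
  assumes K1: "bounded_qlinear K1" and K2: "bounded_qlinear K2"
  shows "bounded_qlinear (map_prod K1 K2)"
proof -
  obtain C1 where C1: "\<And>x. norm (K1 x) \<le> norm x * C1" "0 < C1"
    using bounded_linear.pos_bounded[OF bounded_qlinear_imp_bounded_linear[OF K1]] by blast
  obtain C2 where C2: "\<And>x. norm (K2 x) \<le> norm x * C2" "0 < C2"
    using bounded_linear.pos_bounded[OF bounded_qlinear_imp_bounded_linear[OF K2]] by blast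
  have "norm (map_prod K1 K2 x) \<le> (C1 + C2) * norm x" for x
  proof -
    have "norm (map_prod K1 K2 x) \<le> norm (K1 (fst x)) + norm (K2 (snd x))"
      by (metis fst_map_prod snd_map_prod prod.collapse norm_Pair_le)
    also have "\<dots> \<le> norm (fst x) * C1 + norm (snd x) * C2"
      by (intro add_mono C1 C2)
    also have "\<dots> \<le> norm x * C1 + norm x * C2"
      using C1(2) C2(2) norm_fst_le[of "fst x" "snd x"] norm_snd_le[of "snd x" "fst x"]
      by (intro add_mono mult_right_mono) auto
    finally show ?thesis by (simp add: algebra_simps)
  qed
  then have "\<exists>C. \<forall>x. norm (map_prod K1 K2 x) \<le> C * norm x"
    by blast
  with K1 K2 show ?thesis
    by (simp add: bounded_qlinear_def scaleQ_prod_def prod_eq_iff)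
qed

lemma qadjoint_map_prod:
  assumes "bounded_qlinear K1" "bounded_qlinear K2"
  shows "qadjoint (map_prod K1 K2) = map_prod (qadjoint K1) (qadjoint K2)"
  by (rule qadjoint_eqI) (simp add: qinner_prod_def qinner_qadjoint[OF assms(1)]
      qinner_qadjoint[OF assms(2)])

section \<open>Pythagoras in the space of square integrable functions\<close>

lemma sq_integrable_integrable_norm_sq:
  assumes "g \<in> sq_integrable M"
  shows "integrable M (\<lambda>x. (norm (g x))\<^sup>2)"
  using assms by (auto simp: sq_integrable_def intro!: integrableI_nonneg)

text \<open>
  Real-valued integrals are needed for the cross term, which has no sign; it is dominated
  by \<open>\<bar>g\<bar>\<^sup>2 + \<bar>h\<bar>\<^sup>2\<close>.
\<close>

lemma nn_integral_norm_add_orthogonal: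
  assumes g: "g \<in> sq_integrable M" and h: "h \<in> sq_integrable M"
    and orth: "(\<integral>x. qcnj (g x) * h x \<partial>M) = 0"
  shows "(\<integral>\<^sup>+x. ennreal ((norm (g x + h x))\<^sup>2) \<partial>M) =
    (\<integral>\<^sup>+x. ennreal ((norm (g x))\<^sup>2) \<partial>M) + (\<integral>\<^sup>+x. ennreal ((norm (h x))\<^sup>2) \<partial>M)"
proof -
  have [measurable]: "g \<in> borel_measurable M" "h \<in> borel_measurable M"
    using g h by (auto simp: sq_integrable_def)
  note ig = sq_integrable_integrable_norm_sq[OF g]
  note ih = sq_integrable_integrable_norm_sq[OF h]
  have icross: "integrable M (\<lambda>x. qcnj (g x) * h x)"
  proof (rule Bochner_Integration.integrable_bound[OF Bochner_Integration.integrable_add[OF ig ih]])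
    have "norm (qcnj p * q) \<le> norm ((norm p)\<^sup>2 + (norm q)\<^sup>2)" for p q :: quat
    proof -
      have "norm (qcnj p * q) \<le> norm p * norm q"
        using norm_mult_ineq[of "qcnj p" q] by (simp add: norm_qcnj)
      also have "\<dots> \<le> (norm p)\<^sup>2 + (norm q)\<^sup>2"
        using sum_squares_bound[of "norm p" "norm q"]
          mult_nonneg_nonneg[OF norm_ge_zero norm_ge_zero, of p q]
        by linarith
      finally show ?thesis by simp
    qed
    then show "AE x in M. norm (qcnj (g x) * h x) \<le> norm ((norm (g x))\<^sup>2 + (norm (h x))\<^sup>2)"
      by simp
  qed measurable
  have iinner: "integrable M (\<lambda>x. inner (g x) (h x))"
    using integrable_bounded_linear[OF bounded_linear_qRe icross] by (simp add: qRe_qcnj_times)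
  have cross: "(\<integral>x. inner (g x) (h x) \<partial>M) = 0"
    using integral_bounded_linear[OF bounded_linear_qRe icross] orth
    by (simp add: qRe_qcnj_times)
  have expand: "(norm (g x + h x))\<^sup>2 = (norm (g x))\<^sup>2 + (norm (h x))\<^sup>2 + 2 * inner (g x) (h x)" for x
    by (simp add: power2_norm_eq_inner inner_add_left inner_add_right inner_commute)
  have isum: "integrable M (\<lambda>x. (norm (g x + h x))\<^sup>2)"
    unfolding expand using ig ih iinner by simp
  have "(\<integral>x. (norm (g x + h x))\<^sup>2 \<partial>M) = (\<integral>x. (norm (g x))\<^sup>2 \<partial>M) + (\<integral>x. (norm (h x))\<^sup>2 \<partial>M)"
    unfolding expand using ig ih iinner cross by simp
  then show ?thesis
    by (simp add: nn_integral_eq_integral[OF isum] nn_integral_eq_integral[OF ig]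
        nn_integral_eq_integral[OF ih] ennreal_plus)
qed

section \<open>Direct sums of frames\<close>

lemma continuous_K_frame_sq_integrable:
  assumes "continuous_K_frame M K F"
  shows "(\<lambda>\<omega>. qinner (F \<omega>) u) \<in> sq_integrable M"
  using assms
  by (auto simp: continuous_K_frame_def weakly_measurable_def sq_integrable_def
      intro: le_less_trans)

theorem theorem9:
  fixes M :: "'o measure"
    and K1 :: "'a::right_quat_hilbert \<Rightarrow> 'a" and K2 :: "'b::right_quat_hilbert \<Rightarrow> 'b"
    and F1 :: "'o \<Rightarrow> 'a" and F2 :: "'o \<Rightarrow> 'b"
  assumes "bounded_qlinear K1" and "bounded_qlinear K2"
    and "continuous_K_frame M K1 F1" and "continuous_K_frame M K2 F2"
    and "L2_orthogonal M (range (transform_op M F1)) (range (transform_op M F2))"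
  shows "continuous_K_frame M (map_prod K1 K2) (\<lambda>\<omega>. (F1 \<omega>, F2 \<omega>))"
proof -
  note sq1 = continuous_K_frame_sq_integrable[OF assms(3)]
  note sq2 = continuous_K_frame_sq_integrable[OF assms(4)]
  define I1 where "I1 u = (\<integral>\<^sup>+\<omega>. ennreal ((norm (qinner (F1 \<omega>) u))\<^sup>2) \<partial>M)" for u
  define I2 where "I2 v = (\<integral>\<^sup>+\<omega>. ennreal ((norm (qinner (F2 \<omega>) v))\<^sup>2) \<partial>M)" for v
  obtain A1 B1 where A1: "0 < A1"
    and lo1: "\<And>u. ennreal (A1 * (norm (qadjoint K1 u))\<^sup>2) \<le> I1 u"
    and up1: "\<And>u. I1 u \<le> ennreal (B1 * (norm u)\<^sup>2)" and AB1: "A1 \<le> B1"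
    using assms(3) unfolding continuous_K_frame_def I1_def by blast
  obtain A2 B2 where A2: "0 < A2"
    and lo2: "\<And>v. ennreal (A2 * (norm (qadjoint K2 v))\<^sup>2) \<le> I2 v"
    and up2: "\<And>v. I2 v \<le> ennreal (B2 * (norm v)\<^sup>2)" and AB2: "A2 \<le> B2"
    using assms(4) unfolding continuous_K_frame_def I2_def by blast
  have orth: "(\<integral>\<omega>. qcnj (qinner (F1 \<omega>) u) * qinner (F2 \<omega>) v \<partial>M) = 0" for u v
    using assms(5) L2_inner_class[OF sq1 sq2]
    by (simp add: L2_orthogonal_def transform_op_def)
  have split: "(\<integral>\<^sup>+\<omega>. ennreal ((norm (qinner (F1 \<omega>, F2 \<omega>) x))\<^sup>2) \<partial>M) = I1 (fst x) + I2 (snd x)"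
    for x
    using nn_integral_norm_add_orthogonal[OF sq1 sq2 orth]
    by (simp add: qinner_prod_def I1_def I2_def)
  have norm_prod_sq: "(norm y)\<^sup>2 = (norm (fst y))\<^sup>2 + (norm (snd y))\<^sup>2" for y :: "'a \<times> 'b"
    by (simp add: norm_prod_def)
  have lower: "ennreal (min A1 A2 * (norm (qadjoint (map_prod K1 K2) x))\<^sup>2) \<le> I1 (fst x) + I2 (snd x)"
    for x
  proof -
    let ?p = "(norm (qadjoint K1 (fst x)))\<^sup>2" and ?q = "(norm (qadjoint K2 (snd x)))\<^sup>2"
    have "ennreal (min A1 A2 * (norm (qadjoint (map_prod K1 K2) x))\<^sup>2)
        = ennreal (min A1 A2 * ?p + min A1 A2 * ?q)"
      by (simp add: qadjoint_map_prod[OF assms(1,2)] norm_prod_sq distrib_left)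
    also have "\<dots> \<le> ennreal (A1 * ?p + A2 * ?q)"
      by (intro ennreal_leI add_mono mult_right_mono) auto
    also have "\<dots> = ennreal (A1 * ?p) + ennreal (A2 * ?q)"
      using A1 A2 by (intro ennreal_plus) auto
    also have "\<dots> \<le> I1 (fst x) + I2 (snd x)"
      by (intro add_mono lo1 lo2)
    finally show ?thesis .
  qed
  have upper: "I1 (fst x) + I2 (snd x) \<le> ennreal (max B1 B2 * (norm x)\<^sup>2)" for x
  proof -
    have "I1 (fst x) + I2 (snd x) \<le> ennreal (B1 * (norm (fst x))\<^sup>2) + ennreal (B2 * (norm (snd x))\<^sup>2)"
      by (intro add_mono up1 up2)
    also have "\<dots> = ennreal (B1 * (norm (fst x))\<^sup>2 + B2 * (norm (snd x))\<^sup>2)"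
      using A1 A2 AB1 AB2 by (intro ennreal_plus[symmetric]) auto
    also have "\<dots> \<le> ennreal (max B1 B2 * (norm (fst x))\<^sup>2 + max B1 B2 * (norm (snd x))\<^sup>2)"
      by (intro ennreal_leI add_mono mult_right_mono) auto
    finally show ?thesis by (simp add: norm_prod_sq distrib_left)
  qed
  have "weakly_measurable M (\<lambda>\<omega>. (F1 \<omega>, F2 \<omega>))"
    using sq1 sq2 by (simp add: weakly_measurable_def qinner_prod_def sq_integrable_def
        borel_measurable_add)
  moreover have "0 < min A1 A2" "min A1 A2 \<le> max B1 B2"
    using A1 A2 AB1 AB2 by auto
  ultimately show ?thesis
    unfolding continuous_K_frame_def split
    using bounded_qlinear_map_prod[OF assms(1,2)] lower upper by blast
qed

end
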